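(* Under Assumption 1 (stated in the context), let $\bm{x}=(\bm{x}_1,\dots,\bm{x}_n)$ be the output of Algorithm 1 (stated in the context) and let $\hat{R}_n^{ISOCP}$ be the optimal objective value of the ISOCP problem (stated in the context). Then the regret and the expected constraint violation of Algorithm 1 compared to the optimal solution of the ISOCP problem are on the order of $\sqrt{n}$, i.e. $$\mathbb{E}\left[\hat{R}_n^{ISOCP}-\sum_{t=1}^n \bm{c}_t^\top \bm{x}_t\right] \le O(\sqrt{n}),$$ $$\mathbb{E}\left[\left\|\left(\bm{g}(\bm{x})-\bm{b}\right)^+\right\|_2\right] \le O(\sqrt{n}),$$ where $\bm{g}(\bm{x})=(g_1(\bm x),\dots,g_m(\bm x))^\top$ with $g_j(\bm{x})=\sum_{t=1}^n \bar{\bm{a}}_{tj}^\top\bm{x}_t+\psi_j\sqrt{\sum_{t=1}^n\bm{x}_t^\top\bm{K}_{tj}\bm{x}_t}$ is the left-hand side of the second-order cone constraints.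
   Context: Setting. $n$ (requests), $m$ (resources), $k$ (schemes per request) are positive integers; $m,k$ are fixed while $n$ varies. For $t=1,\dots,n$ and $j=1,\dots,m$: $\bm{c}_t\in\mathbb{R}^k$, $\bar{\bm{a}}_{tj}\in\mathbb{R}^k$, $\bm{K}_{tj}\in\mathbb{R}^{k\times k}$ is a covariance matrix (symmetric positive semidefinite), and $\bm{b}=(b_1,\dots,b_m)^\top\in\mathbb{R}^m$. The numbers $\psi_1,\dots,\psi_m>0$ are fixed constants (in the paper $\psi_j=\max\{\Phi^{-1}(\eta_j),h^{-1}(\tilde\gamma_j)\}$ for given levels $\eta_j,\tilde\gamma_j$, where $\Phi$ is the standard Gaussian CDF and $h(z)=\frac{e^{-z^2/2}/\sqrt{2\pi}}{1-\Phi(z)}-z$). $\bm{\gamma}_{tj}\in\mathbb{R}^k$ is the vector of square roots of the diagonal entries of $\bm{K}_{tj}$. Put $\tilde{\bm{a}}_{tj}=\bar{\bm{a}}_{tj}+\frac{\psi_j}{\sqrt{n}}\bm{\gamma}_{tj}$, and let $\tilde{\bm{A}}_t\in\mathbb{R}^{m\times k}$ be the matrix with rows $\tilde{\bm{a}}_{t1}^\top,\dots,\tilde{\bm{a}}_{tm}^\top$. Assumption 1. (a) The coefficient tuples $\xi_t=(\bm{c}_t,(\bar{\bm{a}}_{tj})_{j},(\bm{K}_{tj})_{j})$, $t=1,\dots,n$, are sampled i.i.d. from an unknown distribution $\mathcal{P}$. (b) The coefficients are bounded (by constants not depending on $n$). (c) $\bm{b}=n\bm{d}$, where $\bm{d}$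 is bounded with positive upper and lower bounds: $0<\underline{d}\le d_j\le\bar{d}$ for all $j$, with $\underline{d},\bar d$ not depending on $n$. ISOCP problem: maximize $\sum_{t=1}^n\bm{c}_t^\top\bm{x}_t$ subject to $\sum_{t=1}^n\bar{\bm{a}}_{tj}^\top\bm{x}_t+\psi_j\sqrt{\sum_{t=1}^n\bm{x}_t^\top\bm{K}_{tj}\bm{x}_t}\le b_j$ for all $j=1,\dots,m$, and $\bm{1}^\top\bm{x}_t\le1$, $\bm{x}_t\in\{0,1\}^k$ for all $t=1,\dots,n$. Algorithm 1. Initialize $\bm{p}_1=\bm{0}\in\mathbb{R}^m$. For $t=1,\dots,n$: set $v_t=\max_{l=1,\dots,k}(\bm{c}_t^\top-\bm{p}_t^\top\tilde{\bm{A}}_t)\bm{e}_l$, where $\bm{e}_l$ is the $l$-th unit vector of $\mathbb{R}^k$. If $v_t>0$, pick an index $l_t$ randomly from $\{l: v_t=(\bm{c}_t^\top-\bm{p}_t^\top\tilde{\bm{A}}_t)\bm{e}_l\}$ and set $\bm{x}_t=\bm{e}_{l_t}$; otherwise set $\bm{x}_t=\bm{0}$. Then set $\bm{p}_{t+1}=\max\{\bm{p}_t+\frac{1}{\sqrt{n}}(\tilde{\bm{A}}_t\bm{x}_t-\bm{d}),\bm{0}\}$ (componentwise maximum). Output $(\bm{x}_1,\dots,\bm{x}_n)$. Conventions. $\mathbb{E}$ is expectation over the i.i.d. coefficients drawn from $\mathcal{P}$ (and the random tie-breaking of the algorithm). $(\cdot)^+$ is the componentwise positive part. $O(\sqrt{n})$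 denotes a quantity bounded by $C\sqrt{n}$ with a constant $C\ge 0$ not depending on $n$. *)

theory Defs
  imports "HOL-Probability.Probability"
begin

text \<open>
  The coefficients \<open>(c, (a\<^sub>j)\<^sub>j, (K\<^sub>j)\<^sub>j)\<close> of one request. The index type \<open>'m\<close> stands for the resources
  and \<open>'k\<close> for the schemes. Requests are numbered \<open>0, \<dots>, n - 1\<close>.
\<close>

type_synonym ('m, 'k) coeffs = "(real^'k) \<times> (real^'k^'m) \<times> (real^'k^'k^'m)"

definition reward :: "('m::finite, 'k::finite) coeffs \<Rightarrow> real^'k" where
  "reward z = fst z"

definition usage_mean :: "('m::finite, 'k::finite) coeffs \<Rightarrow> real^'k^'m" where
  "usage_mean z = fst (snd z)"

definition usage_cov :: "('m::finite, 'k::finite) coeffs \<Rightarrow> real^'k^'k^'m" where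
  "usage_cov z = snd (snd z)"

definition usage_sd :: "('m::finite, 'k::finite) coeffs \<Rightarrow> real^'k^'m" where
  "usage_sd z = (\<chi> j l. sqrt (usage_cov z $ j $ l $ l))"

definition covariance_matrix :: "real^'k^'k \<Rightarrow> bool" where
  "covariance_matrix K \<longleftrightarrow> transpose K = K \<and> (\<forall>x. 0 \<le> x \<bullet> (K *v x))"


subsection \<open>The integer second-order cone program\<close>

definition objective ::
  "nat \<Rightarrow> (nat \<Rightarrow> ('m::finite, 'k::finite) coeffs) \<Rightarrow> (nat \<Rightarrow> real^'k) \<Rightarrow> real" where
  "objective n \<xi> x = (\<Sum>t<n. reward (\<xi> t) \<bullet> x t)"

definition soc_lhs ::
  "real^'m \<Rightarrow> nat \<Rightarrow> (nat \<Rightarrow> ('m::finite, 'k::finite) coeffs) \<Rightarrow> (nat \<Rightarrow> real^'k) \<Rightarrow> real^'m" where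
  "soc_lhs \<psi> n \<xi> x =
    (\<chi> j. (\<Sum>t<n. (usage_mean (\<xi> t) $ j) \<bullet> x t)
        + \<psi> $ j * sqrt (\<Sum>t<n. x t \<bullet> ((usage_cov (\<xi> t) $ j) *v x t)))"

definition isocp_feasible ::
  "real^'m \<Rightarrow> nat \<Rightarrow> real^'m \<Rightarrow> (nat \<Rightarrow> ('m::finite, 'k::finite) coeffs) \<Rightarrow> (nat \<Rightarrow> real^'k) set" where
  "isocp_feasible \<psi> n b \<xi> =
    {x. (\<forall>j. soc_lhs \<psi> n \<xi> x $ j \<le> b $ j) \<and>
        (\<forall>t<n. (\<Sum>l\<in>UNIV. x t $ l) \<le> 1 \<and> (\<forall>l. x t $ l \<in> {0, 1}))}"

text \<open>The objective takes finitely many values on the feasible set, so the supremum is a maximum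
  whenever the problem is feasible; for \<open>b \<ge> 0\<close> the zero decision is feasible.\<close>

definition isocp_value ::
  "real^'m \<Rightarrow> nat \<Rightarrow> real^'m \<Rightarrow> (nat \<Rightarrow> ('m::finite, 'k::finite) coeffs) \<Rightarrow> real" where
  "isocp_value \<psi> n b \<xi> = (SUP x\<in>isocp_feasible \<psi> n b \<xi>. objective n \<xi> x)"


subsection \<open>The online algorithm\<close>

definition usage_adj :: "real^'m \<Rightarrow> nat \<Rightarrow> ('m::finite, 'k::finite) coeffs \<Rightarrow> real^'k^'m" where
  "usage_adj \<psi> n z = (\<chi> j. usage_mean z $ j + (\<psi> $ j / sqrt (real n)) *\<^sub>R (usage_sd z $ j))"

text \<open>
  Random tie-breaking is modelled by a selector, a random function sending each non-empty
  set of tied indices to one of its elements; a fresh one is drawn for every request. Its law is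
  left arbitrary; uniform tie-breaking is one instance.
\<close>

type_synonym 'k selector = "'k set \<Rightarrow> 'k"

definition valid_selector :: "'k selector \<Rightarrow> bool" where
  "valid_selector s \<longleftrightarrow> (\<forall>S. S \<noteq> {} \<longrightarrow> s S \<in> S)"

definition decision ::
  "real^'m \<Rightarrow> nat \<Rightarrow> real^'m \<Rightarrow> ('m::finite, 'k::finite) coeffs \<times> 'k selector \<Rightarrow> real^'k" where
  "decision \<psi> n p w =
    (let r = reward (fst w) - p v* usage_adj \<psi> n (fst w);
         v = Max (range (\<lambda>l. r $ l))
     in if v > 0 then axis (snd w {l. v = r $ l}) 1 else 0)"

text \<open>\<open>price \<dots> t\<close> is the price vector in force when request \<open>t\<close> (counted from 0) arrives.\<close>

primrec price ::
  "real^'m \<Rightarrow> nat \<Rightarrow> real^'m \<Rightarrow> (nat \<Rightarrow> ('m::finite, 'k::finite) coeffs \<times> 'k selector) \<Rightarrow>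
   nat \<Rightarrow> real^'m" where
  "price \<psi> n d \<omega> 0 = 0"
| "price \<psi> n d \<omega> (Suc t) =
    (let p = price \<psi> n d \<omega> t;
         q = p + (1 / sqrt (real n)) *\<^sub>R
               (usage_adj \<psi> n (fst (\<omega> t)) *v decision \<psi> n p (\<omega> t) - d)
     in (\<chi> j. max (q $ j) 0))"

definition alg_output ::
  "real^'m \<Rightarrow> nat \<Rightarrow> real^'m \<Rightarrow> (nat \<Rightarrow> ('m::finite, 'k::finite) coeffs \<times> 'k selector) \<Rightarrow>
   nat \<Rightarrow> real^'k" where
  "alg_output \<psi> n d \<omega> t = decision \<psi> n (price \<psi> n d \<omega> t) (\<omega> t)"


subsection \<open>Randomness, regret and constraint violation\<close>

text \<open>\<open>n\<close> i.i.d. draws of coefficients from \<open>P\<close>, paired with independent draws of selectors from \<open>T\<close>.\<close>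

definition run_space ::
  "('m::finite, 'k::finite) coeffs measure \<Rightarrow> 'k selector pmf \<Rightarrow> nat \<Rightarrow>
   (nat \<Rightarrow> ('m, 'k) coeffs \<times> 'k selector) measure" where
  "run_space P T n = (\<Pi>\<^sub>M t\<in>{..<n}. P \<Otimes>\<^sub>M measure_pmf T)"

definition regret ::
  "real^'m \<Rightarrow> nat \<Rightarrow> real^'m \<Rightarrow> real^'m \<Rightarrow>
   (nat \<Rightarrow> ('m::finite, 'k::finite) coeffs \<times> 'k selector) \<Rightarrow> real" where
  "regret \<psi> n b d \<omega> =
    isocp_value \<psi> n b (fst \<circ> \<omega>) - objective n (fst \<circ> \<omega>) (alg_output \<psi> n d \<omega>)"

definition violation ::
  "real^'m \<Rightarrow> nat \<Rightarrow> real^'m \<Rightarrow> real^'m \<Rightarrow>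
   (nat \<Rightarrow> ('m::finite, 'k::finite) coeffs \<times> 'k selector) \<Rightarrow> real" where
  "violation \<psi> n b d \<omega> =
    norm (\<chi> j. max ((soc_lhs \<psi> n (fst \<circ> \<omega>) (alg_output \<psi> n d \<omega>) - b) $ j) 0)"

end

theory Submission
  imports Defs
begin

text \<open>
  By Cauchy-Schwarz, every feasible point of the cone program is feasible for the linear program
  with the inflated coefficients \<open>usage_adj\<close>, and every 0-1 decision that satisfies the linear
  constraints violates the cone constraints by at most \<open>O(sqrt n)\<close>. The algorithm is projected
  stochastic subgradient descent on the Lagrangian dual of the linear program. Its prices stay
  bounded because an accepted request pays for the resources it uses, and the final price controls
  the accumulated overuse of each resource; this bounds the violation. For the regret, weak duality
  bounds the expected optimum by \<open>n\<close> times the expected dual function at any fixed price, hence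
  also at the current price, which is independent of the arriving request. The complementary
  slackness terms \<open>p \<bullet> (A x - d)\<close> telescope against \<open>norm p\<^sup>2\<close> and cost \<open>O(sqrt n)\<close>.
\<close>

subsection \<open>The linear relaxation and the price dynamics\<close>

text \<open>By \<open>binary_vector_iff_schemes\<close> these are exactly the decisions allowed for
  one request. Finiteness of the set later turns the optimum into a maximum over finitely many
  decision tuples.\<close>

definition schemes :: "(real^'k::finite) set" where
  "schemes = insert 0 (range (\<lambda>l. axis l 1))"

lemma finite_schemes [simp]: "finite schemes"
  by (simp add: schemes_def)

lemma zero_in_schemes [simp]: "0 \<in> schemes"
  by (simp add: schemes_def)

lemma norm_schemes_le: "x \<in> schemes \<Longrightarrow> norm x \<le> 1"
  by (auto simp: schemes_def norm_axis_1)

lemma binary_vector_iff_schemes: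
  fixes x :: "real^'k::finite"
  shows "(\<Sum>l\<in>UNIV. x $ l) \<le> 1 \<and> (\<forall>l. x $ l \<in> {0, 1}) \<longleftrightarrow> x \<in> schemes"
proof
  assume x: "(\<Sum>l\<in>UNIV. x $ l) \<le> 1 \<and> (\<forall>l. x $ l \<in> {0, 1})"
  show "x \<in> schemes"
  proof (cases "x = 0")
    case False
    then obtain l where l: "x $ l = 1"
      using x by (auto simp: vec_eq_iff)
    have "x $ i = 0" if "i \<noteq> l" for i
    proof -
      \<comment> \<open>A second coordinate equal to 1 would bring the coordinate sum to at least
        2.\<close>
      have "(\<Sum>i\<in>{i, l}. x $ i) \<le> (\<Sum>l\<in>UNIV. x $ l)"
        using x by (intro sum_mono2) (auto, metis zero_le_one order_refl)
      with that l x have "x $ i \<le> 0" by simp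
      with x show ?thesis by (metis insertE not_one_le_zero singletonD)
    qed
    with l have "x = axis l 1"
      by (auto simp: vec_eq_iff axis_def)
    then show ?thesis by (simp add: schemes_def)
  qed simp
next
  assume "x \<in> schemes"
  then show "(\<Sum>l\<in>UNIV. x $ l) \<le> 1 \<and> (\<forall>l. x $ l \<in> {0, 1})"
    by (auto simp: schemes_def axis_def if_distrib)
qed

lemma isocp_feasible_schemes:
  "isocp_feasible \<psi> n b \<xi> =
    {x. (\<forall>j. soc_lhs \<psi> n \<xi> x $ j \<le> b $ j) \<and> (\<forall>t<n. x t \<in> schemes)}"
  unfolding isocp_feasible_def binary_vector_iff_schemes ..

lemma decision_in_schemes: "decision \<psi> n p w \<in> schemes"
  by (auto simp: decision_def schemes_def Let_def)

text \<open>Prices are non-anticipating. This is the pathwise form of the independence between the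
  price at time \<open>t\<close> and the request that arrives then.\<close>

lemma price_cong:
  "(\<And>s. s < t \<Longrightarrow> \<omega> s = \<omega>' s) \<Longrightarrow> price \<psi> n d \<omega> t = price \<psi> n d \<omega>' t"
  by (induction t) (simp_all add: Let_def)

lemma price_nonneg: "0 \<le> price \<psi> n d \<omega> t $ j"
  by (induction t) (simp_all add: Let_def)

text \<open>A unit vector selects a single diagonal entry, so on schemes the quadratic form is
  linear and off-diagonal covariances never enter.\<close>

lemma diag_inner_scheme:
  fixes K :: "real^'k::finite^'k" and x :: "real^'k"
  assumes "x \<in> schemes"
  shows "x \<bullet> (K *v x) = (\<chi> l. K $ l $ l) \<bullet> x"
  using assms
  by (auto simp: schemes_def matrix_vector_mult_basis column_def inner_axis inner_axis')

lemma covariance_diag_nonneg: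
  fixes K :: "real^'k::finite^'k"
  assumes "covariance_matrix K"
  shows "0 \<le> K $ l $ l"
proof -
  have "0 \<le> axis l 1 \<bullet> (K *v axis l 1)"
    using assms by (simp add: covariance_matrix_def)
  also have "\<dots> = K $ l $ l"
    by (simp add: matrix_vector_mult_basis column_def inner_axis')
  finally show ?thesis .
qed

section \<open>Almost sure bounds on one request and constants uniform in the horizon\<close>

lemma norm_vec_le_card:
  fixes v :: "real^'m::finite"
  assumes "\<And>j. \<bar>v $ j\<bar> \<le> B"
  shows "norm v \<le> real CARD('m) * B"
  using norm_le_l1_cart[of v] sum_bounded_above[of UNIV "\<lambda>j. \<bar>v $ j\<bar>" B] assms
  by fastforce

text \<open>Gathers what holds almost surely for one draw, so that everything along a sample path
  can be argued deterministically.\<close>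

definition admissible ::
  "real \<Rightarrow> ('m::finite, 'k::finite) coeffs \<times> 'k selector \<Rightarrow> bool" where
  "admissible D w \<longleftrightarrow>
    (\<forall>j. covariance_matrix (usage_cov (fst w) $ j)) \<and>
    norm (reward (fst w)) \<le> D \<and> norm (usage_mean (fst w)) \<le> D \<and>
    norm (usage_cov (fst w)) \<le> D \<and> valid_selector (snd w)"

text \<open>Only data independent of the horizon are fixed here, so the constants defined in this
  locale are uniform in \<open>n\<close>.\<close>

locale soc_bounds =
  fixes \<psi> :: "real^'m::finite" and D d_lo d_hi :: real
  assumes psi_pos: "\<And>j. 0 < \<psi> $ j"
    and D_nonneg: "0 \<le> D"
    and d_lo_pos: "0 < d_lo"
    and d_lo_le_d_hi: "d_lo \<le> d_hi"
begin

text \<open>The bracket bounds each component of \<open>step\<close>: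
  \<open>D + norm \<psi> * sqrt D\<close> for an inflated usage entry and \<open>d_hi\<close> for
  the budget. The cardinality passes from components to the norm.\<close>

definition step_bound :: real where
  "step_bound = real CARD('m) * (D + norm \<psi> * sqrt D + d_hi)"

text \<open>The quotient is the norm above which the downward drift outweighs the second-order term
  of an update; the last summand is the overshoot of one update from below that threshold.\<close>

definition price_bound :: real where
  "price_bound = (D + step_bound\<^sup>2) / d_lo + step_bound"

text \<open>In units of \<open>sqrt n\<close>, \<open>price_bound\<close> pays for overuse of a
  linear constraint and \<open>norm \<psi> * sqrt D\<close> for the gap between the cone constraint
  and the linear one.\<close>

definition violation_bound :: real where
  "violation_bound = real CARD('m) * (price_bound + norm \<psi> * sqrt D)"

lemma step_bound_nonneg: "0 \<le> step_bound"
  using D_nonneg d_lo_pos d_lo_le_d_hi by (auto simp: step_bound_def)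

lemma price_bound_nonneg: "0 \<le> price_bound"
  using D_nonneg d_lo_pos step_bound_nonneg by (auto simp: price_bound_def)

lemma violation_bound_nonneg: "0 \<le> violation_bound"
  using D_nonneg price_bound_nonneg by (auto simp: violation_bound_def)

lemma psi_le_norm: "\<psi> $ j \<le> norm \<psi>"
  using component_le_norm_cart[of \<psi> j] by simp

end

locale online_soc = soc_bounds \<psi> D d_lo d_hi
  for \<psi> :: "real^'m::finite" and D d_lo d_hi :: real +
  fixes n :: nat and d :: "real^'m"
  assumes n_pos: "n \<ge> 1"
    and d_ge: "\<And>j. d_lo \<le> d $ j" and d_le: "\<And>j. d $ j \<le> d_hi"
begin

abbreviation adj :: "('m, 'k::finite) coeffs \<Rightarrow> real^'k^'m" where
  "adj \<equiv> usage_adj \<psi> n"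

definition reduced :: "real^'m \<Rightarrow> ('m, 'k::finite) coeffs \<times> 'k selector \<Rightarrow> real^'k" where
  "reduced p w = reward (fst w) - p v* adj (fst w)"

text \<open>For a valid selector, adding \<open>p \<bullet> d\<close> gives the contribution of one
  request to the Lagrangian dual function at \<open>p\<close>.\<close>

definition surplus :: "real^'m \<Rightarrow> ('m, 'k::finite) coeffs \<times> 'k selector \<Rightarrow> real" where
  "surplus p w = reduced p w \<bullet> decision \<psi> n p w"

text \<open>For a valid selector this is minus a subgradient at \<open>p\<close> of that dual
  contribution, so adding it to the price is a descent step.\<close>

definition step :: "real^'m \<Rightarrow> ('m, 'k::finite) coeffs \<times> 'k selector \<Rightarrow> real^'m" where
  "step p w = adj (fst w) *v decision \<psi> n p w - d"

section \<open>Greedy choice and bounds for a single request\<close>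

lemma d_pos: "0 < d $ j"
  using d_ge[of j] d_lo_pos by linarith

lemma sqrt_n_ge1: "1 \<le> sqrt (real n)"
  using n_pos by simp

lemma price_Suc:
  "price \<psi> n d \<omega> (Suc t) =
    (\<chi> j. max (price \<psi> n d \<omega> t $ j
      + step (price \<psi> n d \<omega> t) (\<omega> t) $ j / sqrt (real n)) 0)"
  by (simp add: Let_def step_def)

text \<open>Comparing the largest reduced reward with 0, the value of declining, gives the greedy
  value \<open>max v 0\<close>. This is the maximum over all schemes, however ties are
  broken.\<close>

lemma surplus_ge:
  assumes "valid_selector (snd w)" "y \<in> schemes"
  shows "reduced p w \<bullet> y \<le> surplus p w"
proof -
  define v where "v = Max (range (\<lambda>l. reduced p w $ l))"
  define S where "S = {l. v = reduced p w $ l}"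
  have "v \<in> range (\<lambda>l. reduced p w $ l)"
    unfolding v_def by (rule Max_in) auto
  then have "S \<noteq> {}" by (auto simp: S_def)
  with assms(1) have "snd w S \<in> S" by (auto simp: valid_selector_def)
  then have sel: "reduced p w $ snd w S = v" by (simp add: S_def)
  have le: "reduced p w $ l \<le> v" for l
    unfolding v_def by (rule Max_ge) auto
  have "surplus p w = max v 0"
    using sel unfolding surplus_def decision_def reduced_def[symmetric] Let_def
      v_def[symmetric] S_def[symmetric]
    by (auto simp: inner_axis)
  with le assms(2) show ?thesis
    by (auto simp: schemes_def inner_axis le_max_iff_disj)
qed

lemma reduced_inner: "reduced p w \<bullet> y = reward (fst w) \<bullet> y - p \<bullet> (adj (fst w) *v y)"
  by (simp add: reduced_def inner_diff_left dot_lmul_matrix)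

lemma sd_bounds:
  assumes "admissible D w"
  shows "0 \<le> usage_sd (fst w) $ j $ l" "usage_sd (fst w) $ j $ l \<le> sqrt D"
    "(usage_sd (fst w) $ j $ l)\<^sup>2 = usage_cov (fst w) $ j $ l $ l"
proof -
  have nn: "0 \<le> usage_cov (fst w) $ j $ l $ l"
    using assms by (simp add: admissible_def covariance_diag_nonneg)
  have "norm (usage_cov (fst w) $ j $ l $ l) \<le> norm (usage_cov (fst w))"
    by (meson Finite_Cartesian_Product.norm_nth_le order_trans)
  moreover have "norm (usage_cov (fst w)) \<le> D"
    using assms by (simp add: admissible_def)
  ultimately have "usage_cov (fst w) $ j $ l $ l \<le> D" by simp
  with nn show "0 \<le> usage_sd (fst w) $ j $ l" "usage_sd (fst w) $ j $ l \<le> sqrt D"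
    "(usage_sd (fst w) $ j $ l)\<^sup>2 = usage_cov (fst w) $ j $ l $ l"
    by (simp_all add: usage_sd_def)
qed

lemma adj_entry_bound:
  assumes "admissible D w"
  shows "\<bar>adj (fst w) $ j $ l\<bar> \<le> D + norm \<psi> * sqrt D"
proof -
  have "norm (usage_mean (fst w) $ j $ l) \<le> norm (usage_mean (fst w))"
    by (meson Finite_Cartesian_Product.norm_nth_le order_trans)
  then have 1: "\<bar>usage_mean (fst w) $ j $ l\<bar> \<le> D"
    using assms by (simp add: admissible_def)
  \<comment> \<open>Since \<open>sqrt n\<close> is at least 1, the inflation is bounded uniformly in
    the horizon.\<close>
  have "\<psi> $ j / sqrt (real n) \<le> \<psi> $ j / 1"
    using psi_pos[of j] sqrt_n_ge1 by (intro divide_left_mono) auto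
  then have "\<psi> $ j / sqrt (real n) \<le> norm \<psi>"
    using psi_le_norm[of j] by simp
  then have "\<psi> $ j / sqrt (real n) * usage_sd (fst w) $ j $ l \<le> norm \<psi> * sqrt D"
    using sd_bounds[OF assms] D_nonneg by (intro mult_mono) auto
  moreover have "0 \<le> \<psi> $ j / sqrt (real n) * usage_sd (fst w) $ j $ l"
    using sd_bounds[OF assms] psi_pos[of j] by simp
  ultimately show ?thesis
    using 1 by (simp add: usage_adj_def abs_le_iff)
qed

lemma adj_mult_component_bound:
  assumes "admissible D w" "y \<in> schemes"
  shows "\<bar>(adj (fst w) *v y) $ j\<bar> \<le> D + norm \<psi> * sqrt D"
  using assms(2) adj_entry_bound[OF assms(1)] D_nonneg
  by (auto simp: schemes_def matrix_vector_mult_basis column_def)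

lemma norm_step_le:
  assumes "admissible D w"
  shows "norm (step p w) \<le> step_bound"
  unfolding step_bound_def
proof (rule norm_vec_le_card)
  fix j
  show "\<bar>step p w $ j\<bar> \<le> D + norm \<psi> * sqrt D + d_hi"
    using adj_mult_component_bound[OF assms decision_in_schemes, of \<psi> n p w j]
      d_pos[of j] d_le[of j] by (simp add: step_def abs_le_iff)
qed

lemma reward_inner_bound:
  assumes "admissible D w" "y \<in> schemes"
  shows "\<bar>reward (fst w) \<bullet> y\<bar> \<le> D"
proof -
  have "\<bar>reward (fst w) \<bullet> y\<bar> \<le> norm (reward (fst w)) * norm y"
    by (rule Cauchy_Schwarz_ineq2)
  also have "\<dots> \<le> D * 1"
    using assms norm_schemes_le[OF assms(2)] D_nonneg
    by (intro mult_mono) (auto simp: admissible_def)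
  finally show ?thesis by simp
qed

lemma surplus_nonneg: "admissible D w \<Longrightarrow> 0 \<le> surplus p w"
  using surplus_ge[of w 0 p] by (auto simp: admissible_def)

section \<open>Drift and boundedness of the prices\<close>

lemma norm_le_inner_d:
  assumes "\<And>j. 0 \<le> p $ j"
  shows "d_lo * norm p \<le> p \<bullet> d"
proof -
  have "d_lo * norm p \<le> d_lo * (\<Sum>j\<in>UNIV. \<bar>p $ j\<bar>)"
    using norm_le_l1_cart[of p] d_lo_pos by simp
  also have "\<dots> = (\<Sum>j\<in>UNIV. p $ j * d_lo)"
    using assms by (simp add: sum_distrib_left mult.commute)
  also have "\<dots> \<le> (\<Sum>j\<in>UNIV. p $ j * d $ j)"
    using assms d_ge by (intro sum_mono mult_left_mono) auto
  finally show ?thesis by (simp add: inner_vec_def)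
qed

text \<open>The greedy choice only accepts a request of nonnegative surplus, so the used resources are
  worth at most \<open>D\<close> at current prices while the budget is worth at least \<open>d_lo * norm p\<close>: large
  prices drift downwards.\<close>

lemma inner_step_le:
  assumes "admissible D w" "\<And>j. 0 \<le> p $ j"
  shows "p \<bullet> step p w \<le> D - d_lo * norm p"
proof -
  have "0 \<le> reward (fst w) \<bullet> decision \<psi> n p w - p \<bullet> (adj (fst w) *v decision \<psi> n p w)"
    using surplus_nonneg[OF assms(1), of p] by (simp add: surplus_def reduced_inner)
  moreover have "reward (fst w) \<bullet> decision \<psi> n p w \<le> D"
    using reward_inner_bound[OF assms(1) decision_in_schemes, of \<psi> n p w] by linarith
  ultimately show ?thesis
    using norm_le_inner_d[OF assms(2)] by (simp add: step_def inner_diff_right)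
qed

text \<open>Clipping at zero never increases the absolute value of a coordinate.\<close>

lemma norm_price_Suc_le:
  "norm (price \<psi> n d \<omega> (Suc t))
    \<le> norm (price \<psi> n d \<omega> t + (1 / sqrt (real n)) *\<^sub>R step (price \<psi> n d \<omega> t) (\<omega> t))"
  unfolding price_Suc by (rule norm_le_componentwise_cart) auto

text \<open>Expands the square of the unclipped update. The cross term is kept because it serves
  twice: its upper bound keeps prices bounded, and its telescoped sum controls the regret.\<close>

lemma norm_price_Suc_sq_le:
  assumes "admissible D (\<omega> t)"
  defines "p \<equiv> price \<psi> n d \<omega> t"
  shows "(norm (price \<psi> n d \<omega> (Suc t)))\<^sup>2
    \<le> (norm p)\<^sup>2 + 2 / sqrt (real n) * (p \<bullet> step p (\<omega> t)) + step_bound\<^sup>2 / real n"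
proof -
  define q where "q = step p (\<omega> t)"
  have "(norm (price \<psi> n d \<omega> (Suc t)))\<^sup>2 \<le> (norm (p + (1 / sqrt (real n)) *\<^sub>R q))\<^sup>2"
    unfolding p_def q_def by (intro power_mono norm_price_Suc_le) simp
  also have "\<dots> = (norm p)\<^sup>2 + 2 / sqrt (real n) * (p \<bullet> q) + (norm q)\<^sup>2 / real n"
    unfolding power2_norm_eq_inner
    by (simp add: inner_add_left inner_add_right inner_commute)
  also have "\<dots> \<le> (norm p)\<^sup>2 + 2 / sqrt (real n) * (p \<bullet> q) + step_bound\<^sup>2 / real n"
    using norm_step_le[OF assms(1)]
    by (intro add_left_mono divide_right_mono power_mono) (auto simp: q_def)
  finally show ?thesis unfolding q_def .
qed

text \<open>Above the threshold in \<open>price_bound\<close> the drift makes the norm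
  nonincreasing; below it, one update adds at most \<open>step_bound\<close>.\<close>

lemma norm_price_le:
  assumes "\<And>s. s < t \<Longrightarrow> admissible D (\<omega> s)"
  shows "norm (price \<psi> n d \<omega> t) \<le> price_bound"
  using assms
proof (induction t)
  case 0
  then show ?case using price_bound_nonneg by simp
next
  case (Suc t)
  define p where "p = price \<psi> n d \<omega> t"
  have IH: "norm p \<le> price_bound" unfolding p_def using Suc by simp
  have adm: "admissible D (\<omega> t)" using Suc by simp
  show ?case
  proof (cases "(D + step_bound\<^sup>2) / d_lo \<le> norm p")
    case True
    then have "D + step_bound\<^sup>2 \<le> d_lo * norm p"
      using d_lo_pos by (simp add: field_simps)
    then have "p \<bullet> step p (\<omega> t) \<le> - step_bound\<^sup>2"
      using inner_step_le[OF adm, of p] price_nonneg[of \<psi> n d \<omega> t] by (simp add: p_def)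
    then have "2 / sqrt (real n) * (p \<bullet> step p (\<omega> t)) \<le> 2 / sqrt (real n) * (- step_bound\<^sup>2)"
      by (intro mult_left_mono) auto
    \<comment> \<open>The drift is of order \<open>1 / sqrt n\<close> and the second-order term of
      order \<open>1 / n\<close>, which is no larger because \<open>n\<close> is at least 1.\<close>
    also have "\<dots> \<le> - (step_bound\<^sup>2 / real n)"
    proof -
      have "sqrt (real n) * 1 \<le> sqrt (real n) * sqrt (real n)"
        using sqrt_n_ge1 by (intro mult_left_mono) auto
      then have "sqrt (real n) \<le> real n" by simp
      then have "1 / real n \<le> 1 / sqrt (real n)"
        using sqrt_n_ge1 by (intro divide_left_mono) (auto intro!: mult_pos_pos)
      also have "\<dots> \<le> 2 / sqrt (real n)"
        by (intro divide_right_mono) auto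
      finally have "step_bound\<^sup>2 * (1 / real n) \<le> step_bound\<^sup>2 * (2 / sqrt (real n))"
        by (intro mult_left_mono) auto
      then show ?thesis by (simp add: mult.commute)
    qed
    finally have "(norm (price \<psi> n d \<omega> (Suc t)))\<^sup>2 \<le> (norm p)\<^sup>2"
      using norm_price_Suc_sq_le[of \<omega> t, OF adm] unfolding p_def by linarith
    then have "norm (price \<psi> n d \<omega> (Suc t)) \<le> norm p"
      by (rule power2_le_imp_le) simp
    then show ?thesis using IH by linarith
  next
    case False
    have "norm (price \<psi> n d \<omega> (Suc t)) \<le> norm (p + (1 / sqrt (real n)) *\<^sub>R step p (\<omega> t))"
      unfolding p_def by (rule norm_price_Suc_le)
    also have "\<dots> \<le> norm p + norm ((1 / sqrt (real n)) *\<^sub>R step p (\<omega> t))"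
      by (rule norm_triangle_ineq)
    also have "norm ((1 / sqrt (real n)) *\<^sub>R step p (\<omega> t)) \<le> 1 * norm (step p (\<omega> t))"
      unfolding norm_scaleR using sqrt_n_ge1 by (intro mult_right_mono) auto
    also have "\<dots> \<le> step_bound" using norm_step_le[OF adm] by simp
    finally show ?thesis using False by (simp add: price_bound_def)
  qed
qed

text \<open>Without clipping, the price would equal the accumulated steps divided by
  \<open>sqrt n\<close>; clipping can only raise it. A bounded price therefore caps the overuse at
  order \<open>sqrt n\<close>.\<close>

lemma sum_step_le_price:
  "(\<Sum>s<t. step (price \<psi> n d \<omega> s) (\<omega> s) $ j) \<le> sqrt (real n) * price \<psi> n d \<omega> t $ j"
proof (induction t)
  case (Suc t)
  let ?p = "price \<psi> n d \<omega> t"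
  have "(\<Sum>s<Suc t. step (price \<psi> n d \<omega> s) (\<omega> s) $ j)
      \<le> sqrt (real n) * (?p $ j + step ?p (\<omega> t) $ j / sqrt (real n))"
    using Suc sqrt_n_ge1 by (simp add: distrib_left)
  also have "\<dots> \<le> sqrt (real n) * price \<psi> n d \<omega> (Suc t) $ j"
    unfolding price_Suc by (intro mult_left_mono) auto
  finally show ?case .
qed simp

text \<open>The recursion for the squared norm telescopes from the zero initial price. The final
  squared norm is nonnegative, which keeps the sum of the cross terms from being too
  negative.\<close>

lemma sum_inner_step_ge:
  assumes "\<And>s. s < t \<Longrightarrow> admissible D (\<omega> s)"
  shows "- (real t * step_bound\<^sup>2) / (2 * sqrt (real n))
    \<le> (\<Sum>s<t. price \<psi> n d \<omega> s \<bullet> step (price \<psi> n d \<omega> s) (\<omega> s))"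
proof -
  have "(norm (price \<psi> n d \<omega> t))\<^sup>2 \<le>
    2 / sqrt (real n) * (\<Sum>s<t. price \<psi> n d \<omega> s \<bullet> step (price \<psi> n d \<omega> s) (\<omega> s))
    + real t * step_bound\<^sup>2 / real n"
    using assms
  proof (induction t)
    case (Suc t)
    have "(norm (price \<psi> n d \<omega> t))\<^sup>2 \<le>
      2 / sqrt (real n) * (\<Sum>s<t. price \<psi> n d \<omega> s \<bullet> step (price \<psi> n d \<omega> s) (\<omega> s))
      + real t * step_bound\<^sup>2 / real n"
      using Suc by simp
    then show ?case
      using norm_price_Suc_sq_le[of \<omega> t] Suc.prems
      by (simp add: distrib_left distrib_right add_divide_distrib)
  qed simp
  then have "0 \<le> 2 / sqrt (real n) * (\<Sum>s<t. price \<psi> n d \<omega> s \<bullet> step (price \<psi> n d \<omega> s) (\<omega> s))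
    + real t * step_bound\<^sup>2 / real n"
    by (rule order_trans[OF zero_le_power2])
  then have "0 \<le> sqrt (real n) / 2 * (2 / sqrt (real n) *
      (\<Sum>s<t. price \<psi> n d \<omega> s \<bullet> step (price \<psi> n d \<omega> s) (\<omega> s))
    + real t * step_bound\<^sup>2 / real n)"
    by simp
  also have "\<dots> = (\<Sum>s<t. price \<psi> n d \<omega> s \<bullet> step (price \<psi> n d \<omega> s) (\<omega> s))
    + real t * step_bound\<^sup>2 * (sqrt (real n) / real n) / 2"
    using sqrt_n_ge1 by (simp add: distrib_left mult_ac)
  also have "sqrt (real n) / real n = 1 / sqrt (real n)"
    using n_pos by (simp add: real_div_sqrt field_simps)
  finally show ?thesis by (simp add: mult.commute)
qed

section \<open>Cone constraints against inflated linear constraints\<close>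

lemma adj_mult_component:
  "(adj z *v y) $ j = usage_mean z $ j \<bullet> y + \<psi> $ j * (usage_sd z $ j \<bullet> y) / sqrt (real n)"
  by (simp add: matrix_vector_mul_component usage_adj_def inner_add_left)

lemma scheme_variance:
  assumes "admissible D w" "y \<in> schemes"
  shows "y \<bullet> ((usage_cov (fst w) $ j) *v y) = (usage_sd (fst w) $ j \<bullet> y)\<^sup>2"
  using assms(2) sd_bounds[OF assms(1)]
  by (auto simp: schemes_def diag_inner_scheme inner_axis)

lemma sd_inner_bounds:
  assumes "admissible D w" "y \<in> schemes"
  shows "0 \<le> usage_sd (fst w) $ j \<bullet> y" "usage_sd (fst w) $ j \<bullet> y \<le> sqrt D"
  using assms(2) sd_bounds[OF assms(1)] D_nonneg
  by (auto simp: schemes_def inner_axis)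

text \<open>Cauchy-Schwarz: linearising the cone constraint with the factor \<open>1 / sqrt n\<close> relaxes it.\<close>

lemma sum_adj_le_soc_lhs:
  assumes "\<And>t. t < n \<Longrightarrow> admissible D (\<omega> t)" "\<And>t. t < n \<Longrightarrow> x t \<in> schemes"
  shows "(\<Sum>t<n. (adj (fst (\<omega> t)) *v x t) $ j) \<le> soc_lhs \<psi> n (fst \<circ> \<omega>) x $ j"
proof -
  let ?s = "\<lambda>t. usage_sd (fst (\<omega> t)) $ j \<bullet> x t"
  \<comment> \<open>The second sequence is constantly 1; it produces the factor
    \<open>sqrt n\<close> that cancels the \<open>1 / sqrt n\<close> of the inflation.\<close>
  have "(\<Sum>t<n. ?s t)\<^sup>2 \<le> (\<Sum>t<n. (?s t)\<^sup>2) * real n"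
    using Cauchy_Schwarz_ineq_sum[of ?s "\<lambda>_. 1" "{..<n}"] by simp
  then have "(\<Sum>t<n. ?s t) \<le> sqrt (\<Sum>t<n. (?s t)\<^sup>2) * sqrt (real n)"
    unfolding real_sqrt_mult[symmetric] by (rule real_le_rsqrt)
  then have "(\<Sum>t<n. ?s t) / sqrt (real n) \<le> sqrt (\<Sum>t<n. (?s t)\<^sup>2)"
    using sqrt_n_ge1 by (simp add: divide_le_eq)
  then have "\<psi> $ j * ((\<Sum>t<n. ?s t) / sqrt (real n)) \<le> \<psi> $ j * sqrt (\<Sum>t<n. (?s t)\<^sup>2)"
    using psi_pos[of j] by (intro mult_left_mono) auto
  moreover have "(\<Sum>t<n. (adj (fst (\<omega> t)) *v x t) $ j) =
    (\<Sum>t<n. usage_mean (fst (\<omega> t)) $ j \<bullet> x t) + \<psi> $ j * ((\<Sum>t<n. ?s t) / sqrt (real n))"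
    by (simp add: adj_mult_component sum.distrib sum_distrib_left sum_divide_distrib)
  moreover have "(\<Sum>t<n. x t \<bullet> ((usage_cov (fst (\<omega> t)) $ j) *v x t)) = (\<Sum>t<n. (?s t)\<^sup>2)"
    using assms by (intro sum.cong) (auto simp: scheme_variance)
  ultimately show ?thesis by (simp add: soc_lhs_def)
qed

text \<open>Each request contributes variance at most \<open>D\<close>, so the root is at most
  \<open>sqrt (D * n)\<close>; the mean usage is dominated by the inflated usage because the
  inflation is nonnegative.\<close>

lemma soc_lhs_le_sum_adj:
  assumes "\<And>t. t < n \<Longrightarrow> admissible D (\<omega> t)" "\<And>t. t < n \<Longrightarrow> x t \<in> schemes"
  shows "soc_lhs \<psi> n (fst \<circ> \<omega>) x $ j
    \<le> (\<Sum>t<n. (adj (fst (\<omega> t)) *v x t) $ j) + norm \<psi> * sqrt D * sqrt (real n)"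
proof -
  let ?s = "\<lambda>t. usage_sd (fst (\<omega> t)) $ j \<bullet> x t"
  have "(?s t)\<^sup>2 \<le> D" if "t < n" for t
    using power_mono[OF sd_inner_bounds(2)[OF assms[OF that], of j]
        sd_inner_bounds(1)[OF assms[OF that], of j], of 2] D_nonneg by simp
  then have "(\<Sum>t<n. (?s t)\<^sup>2) \<le> D * real n"
    using sum_bounded_above[of "{..<n}" "\<lambda>t. (?s t)\<^sup>2" D] by (simp add: mult.commute)
  then have "sqrt (\<Sum>t<n. (?s t)\<^sup>2) \<le> sqrt D * sqrt (real n)"
    unfolding real_sqrt_mult[symmetric] by simp
  then have "\<psi> $ j * sqrt (\<Sum>t<n. (?s t)\<^sup>2) \<le> norm \<psi> * (sqrt D * sqrt (real n))"
    using psi_le_norm[of j] psi_pos[of j] by (intro mult_mono) (auto intro!: sum_nonneg)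
  moreover have "(\<Sum>t<n. usage_mean (fst (\<omega> t)) $ j \<bullet> x t) \<le> (\<Sum>t<n. (adj (fst (\<omega> t)) *v x t) $ j)"
  proof (rule sum_mono)
    fix t assume "t \<in> {..<n}"
    then have t: "t < n" by simp
    have "0 \<le> \<psi> $ j * ?s t / sqrt (real n)"
      using psi_pos[of j] sd_inner_bounds(1)[OF assms[OF t]] by simp
    then show "usage_mean (fst (\<omega> t)) $ j \<bullet> x t \<le> (adj (fst (\<omega> t)) *v x t) $ j"
      by (simp add: adj_mult_component)
  qed
  moreover have "(\<Sum>t<n. x t \<bullet> ((usage_cov (fst (\<omega> t)) $ j) *v x t)) = (\<Sum>t<n. (?s t)\<^sup>2)"
    using assms by (intro sum.cong) (auto simp: scheme_variance)
  ultimately show ?thesis by (simp add: soc_lhs_def mult.assoc)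
qed

section \<open>Violation along a sample path\<close>

lemma alg_output_in_schemes: "alg_output \<psi> n d \<omega> t \<in> schemes"
  by (simp add: alg_output_def decision_in_schemes)

lemma violation_le:
  assumes "\<And>t. t < n \<Longrightarrow> admissible D (\<omega> t)"
  shows "violation \<psi> n (real n *\<^sub>R d) d \<omega> \<le> violation_bound * sqrt (real n)"
proof -
  have "norm (\<chi> j. max ((soc_lhs \<psi> n (fst \<circ> \<omega>) (alg_output \<psi> n d \<omega>) - real n *\<^sub>R d) $ j) 0)
     \<le> real CARD('m) * ((price_bound + norm \<psi> * sqrt D) * sqrt (real n))"
  proof (rule norm_vec_le_card)
    fix j
    have "(\<Sum>t<n. (adj (fst (\<omega> t)) *v alg_output \<psi> n d \<omega> t) $ j) - real n * d $ j
        = (\<Sum>t<n. step (price \<psi> n d \<omega> t) (\<omega> t) $ j)"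
      by (simp add: step_def alg_output_def sum_subtractf)
    also have "\<dots> \<le> sqrt (real n) * price \<psi> n d \<omega> n $ j"
      by (rule sum_step_le_price)
    also have "\<dots> \<le> sqrt (real n) * price_bound"
      using component_le_norm_cart[of "price \<psi> n d \<omega> n" j] norm_price_le[of n \<omega>] assms
      by (intro mult_left_mono) auto
    finally have "soc_lhs \<psi> n (fst \<circ> \<omega>) (alg_output \<psi> n d \<omega>) $ j - real n * d $ j
      \<le> (price_bound + norm \<psi> * sqrt D) * sqrt (real n)"
      using soc_lhs_le_sum_adj[of \<omega> "alg_output \<psi> n d \<omega>" j, OF assms alg_output_in_schemes]
      by (simp add: algebra_simps)
    then show "\<bar>(\<chi> j. max ((soc_lhs \<psi> n (fst \<circ> \<omega>) (alg_output \<psi> n d \<omega>) - real n *\<^sub>R d) $ j) 0) $ j\<bar>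
        \<le> (price_bound + norm \<psi> * sqrt D) * sqrt (real n)"
      using price_bound_nonneg D_nonneg by simp
  qed
  then show ?thesis by (simp add: violation_def violation_bound_def mult.assoc)
qed

section \<open>Weak duality and the collected reward along a sample path\<close>

lemma zero_feasible: "(\<lambda>_. 0) \<in> isocp_feasible \<psi> n (real n *\<^sub>R d) \<xi>"
  using d_pos by (simp add: isocp_feasible_def soc_lhs_def less_imp_le)

lemma objective_bound:
  assumes "\<And>t. t < n \<Longrightarrow> admissible D (\<omega> t)" "\<And>t. t < n \<Longrightarrow> x t \<in> schemes"
  shows "\<bar>objective n (fst \<circ> \<omega>) x\<bar> \<le> real n * D"
proof -
  have "\<bar>objective n (fst \<circ> \<omega>) x\<bar> \<le> (\<Sum>t<n. \<bar>reward (fst (\<omega> t)) \<bullet> x t\<bar>)"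
    unfolding objective_def by (rule order_trans[OF sum_abs]) simp
  also have "\<dots> \<le> real n * D"
    using sum_bounded_above[of "{..<n}" "\<lambda>t. \<bar>reward (fst (\<omega> t)) \<bullet> x t\<bar>" D]
      reward_inner_bound[OF assms] by simp
  finally show ?thesis .
qed

text \<open>Supplies the integrability of the optimum. The zero decision gives the lower bound and
  shows that the supremum is over a nonempty set.\<close>

lemma isocp_value_bound:
  assumes "\<And>t. t < n \<Longrightarrow> admissible D (\<omega> t)"
  shows "\<bar>isocp_value \<psi> n (real n *\<^sub>R d) (fst \<circ> \<omega>)\<bar> \<le> real n * D"
proof -
  let ?F = "isocp_feasible \<psi> n (real n *\<^sub>R d) (fst \<circ> \<omega>)"
  have le: "objective n (fst \<circ> \<omega>) x \<le> real n * D" if "x \<in> ?F" for x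
    using objective_bound[of \<omega> x] assms that by (auto simp: isocp_feasible_schemes)
  have "objective n (fst \<circ> \<omega>) (\<lambda>_. 0) \<le> isocp_value \<psi> n (real n *\<^sub>R d) (fst \<circ> \<omega>)"
    unfolding isocp_value_def
    by (rule cSUP_upper[OF zero_feasible bdd_aboveI2[OF le]])
  moreover have "isocp_value \<psi> n (real n *\<^sub>R d) (fst \<circ> \<omega>) \<le> real n * D"
    unfolding isocp_value_def using zero_feasible by (intro cSUP_least le) auto
  ultimately show ?thesis by (simp add: objective_def)
qed

text \<open>Weak duality: a cone-feasible point satisfies the inflated linear constraints, which are
  priced by \<open>p\<close>; what remains separates over requests and is maximised by the greedy
  choice in each.\<close>

lemma isocp_value_le_dual:
  assumes "\<And>t. t < n \<Longrightarrow> admissible D (\<omega> t)" "\<And>j. 0 \<le> p $ j"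
  shows "isocp_value \<psi> n (real n *\<^sub>R d) (fst \<circ> \<omega>) \<le> (\<Sum>t<n. surplus p (\<omega> t) + p \<bullet> d)"
  unfolding isocp_value_def
proof (rule cSUP_least)
  show "isocp_feasible \<psi> n (real n *\<^sub>R d) (fst \<circ> \<omega>) \<noteq> {}"
    using zero_feasible by blast
next
  fix x assume "x \<in> isocp_feasible \<psi> n (real n *\<^sub>R d) (fst \<circ> \<omega>)"
  then have soc: "\<And>j. soc_lhs \<psi> n (fst \<circ> \<omega>) x $ j \<le> real n * d $ j"
    and x: "\<And>t. t < n \<Longrightarrow> x t \<in> schemes"
    by (auto simp: isocp_feasible_schemes)
  have "(\<Sum>t<n. p \<bullet> (adj (fst (\<omega> t)) *v x t)) = p \<bullet> (\<Sum>t<n. adj (fst (\<omega> t)) *v x t)"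
    by (simp add: inner_sum_right)
  also have "\<dots> \<le> p \<bullet> (real n *\<^sub>R d)"
    unfolding inner_vec_def
  proof (rule sum_mono)
    fix j
    have "(\<Sum>t<n. adj (fst (\<omega> t)) *v x t) $ j \<le> real n * d $ j"
      using order_trans[OF sum_adj_le_soc_lhs[OF assms(1) x] soc] by simp
    then show "p $ j \<bullet> (\<Sum>t<n. adj (fst (\<omega> t)) *v x t) $ j \<le> p $ j \<bullet> (real n *\<^sub>R d) $ j"
      using assms(2) by (simp add: mult_left_mono)
  qed
  finally have 1: "(\<Sum>t<n. p \<bullet> (adj (fst (\<omega> t)) *v x t)) \<le> real n * (p \<bullet> d)" by simp
  have "objective n (fst \<circ> \<omega>) x
      = (\<Sum>t<n. reduced p (\<omega> t) \<bullet> x t) + (\<Sum>t<n. p \<bullet> (adj (fst (\<omega> t)) *v x t))"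
    by (simp add: objective_def reduced_inner sum.distrib[symmetric])
  also have "\<dots> \<le> (\<Sum>t<n. surplus p (\<omega> t)) + real n * (p \<bullet> d)"
    using 1 x assms(1) by (intro add_mono sum_mono surplus_ge) (auto simp: admissible_def)
  finally show "objective n (fst \<circ> \<omega>) x \<le> (\<Sum>t<n. surplus p (\<omega> t) + p \<bullet> d)"
    by (simp add: sum.distrib)
qed

text \<open>The collected reward equals the dual contributions at the running prices plus the
  complementary slackness sum, which \<open>sum_inner_step_ge\<close> bounds from below.\<close>

lemma objective_alg_ge:
  assumes "\<And>t. t < n \<Longrightarrow> admissible D (\<omega> t)"
  shows "(\<Sum>t<n. surplus (price \<psi> n d \<omega> t) (\<omega> t) + price \<psi> n d \<omega> t \<bullet> d)
      - step_bound\<^sup>2 / 2 * sqrt (real n)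
    \<le> objective n (fst \<circ> \<omega>) (alg_output \<psi> n d \<omega>)"
proof -
  have "objective n (fst \<circ> \<omega>) (alg_output \<psi> n d \<omega>) =
    (\<Sum>t<n. surplus (price \<psi> n d \<omega> t) (\<omega> t) + price \<psi> n d \<omega> t \<bullet> d)
    + (\<Sum>t<n. price \<psi> n d \<omega> t \<bullet> step (price \<psi> n d \<omega> t) (\<omega> t))"
    by (simp add: objective_def alg_output_def surplus_def reduced_inner step_def
        inner_diff_right sum.distrib[symmetric])
  moreover have "- (real n * step_bound\<^sup>2) / (2 * sqrt (real n)) = - (step_bound\<^sup>2 / 2 * sqrt (real n))"
    using n_pos by (simp add: field_simps)
  ultimately show ?thesis
    using sum_inner_step_ge[of n \<omega>] assms by simp
qed

text \<open>Meant for integrability only, so a crude estimate through \<open>step p w + d\<close>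
  suffices.\<close>

lemma surplus_bound:
  assumes "admissible D w"
  shows "\<bar>surplus p w\<bar> \<le> D + norm p * (step_bound + norm d)"
proof -
  have "\<bar>p \<bullet> (adj (fst w) *v decision \<psi> n p w)\<bar> \<le> norm p * norm (step p w + d)"
    by (simp add: step_def Cauchy_Schwarz_ineq2)
  also have "\<dots> \<le> norm p * (step_bound + norm d)"
    using norm_step_le[OF assms, of p]
    by (intro mult_left_mono order_trans[OF norm_triangle_ineq]) auto
  finally show ?thesis
    using reward_inner_bound[OF assms decision_in_schemes, of \<psi> n p w]
    by (simp add: surplus_def reduced_inner)
qed

end

subsection \<open>Measurability\<close>

lemma borel_measurable_vec_nth [measurable (raw)]:
  fixes f :: "'a \<Rightarrow> ('b::topological_space)^'n::finite"
  assumes "f \<in> borel_measurable M"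
  shows "(\<lambda>x. f x $ i) \<in> borel_measurable M"
  by (rule borel_measurable_continuous_on[OF _ assms]) (intro continuous_intros)

lemma borel_measurable_vec_lambda [measurable (raw)]:
  fixes f :: "'n::finite \<Rightarrow> 'a \<Rightarrow> 'b::euclidean_space"
  assumes "\<And>i. f i \<in> borel_measurable M"
  shows "(\<lambda>x. \<chi> i. f i x) \<in> borel_measurable M"
  using assms by (subst borel_measurable_euclidean_space) (auto simp: Basis_vec_def inner_axis)

lemma borel_measurable_matrix_vector_mult [measurable (raw)]:
  fixes A :: "'a \<Rightarrow> real^'n::finite^'m::finite"
  assumes [measurable]: "A \<in> borel_measurable M" "y \<in> borel_measurable M"
  shows "(\<lambda>x. A x *v y x) \<in> borel_measurable M"
  unfolding matrix_vector_mult_def by measurable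

lemma borel_measurable_vector_matrix_mult [measurable (raw)]:
  fixes A :: "'a \<Rightarrow> real^'n::finite^'m::finite"
  assumes [measurable]: "A \<in> borel_measurable M" "y \<in> borel_measurable M"
  shows "(\<lambda>x. y x v* A x) \<in> borel_measurable M"
  unfolding vector_matrix_mult_def by measurable

lemma borel_measurable_coeffs [measurable (raw)]:
  assumes "f \<in> borel_measurable M"
  shows "(\<lambda>x. reward (f x)) \<in> borel_measurable M"
    and "(\<lambda>x. usage_mean (f x)) \<in> borel_measurable M"
    and "(\<lambda>x. usage_cov (f x)) \<in> borel_measurable M"
  unfolding reward_def usage_mean_def usage_cov_def
  by (rule borel_measurable_continuous_on[OF _ assms], intro continuous_intros)+

lemma borel_measurable_usage_adj [measurable (raw)]:
  assumes [measurable]: "f \<in> borel_measurable M"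
  shows "(\<lambda>x. usage_adj \<psi> n (f x)) \<in> borel_measurable M"
  unfolding usage_adj_def usage_sd_def by measurable

text \<open>Measurability is asked only of coordinates below \<open>n\<close>, since the run space
  is a product over \<open>{..<n}\<close>.\<close>

lemma borel_measurable_soc_lhs:
  assumes [measurable]: "\<And>t. t < n \<Longrightarrow> (\<lambda>w. \<xi> w t) \<in> borel_measurable M"
    "\<And>t. t < n \<Longrightarrow> (\<lambda>w. x w t) \<in> borel_measurable M"
  shows "(\<lambda>w. soc_lhs \<psi> n (\<xi> w) (x w)) \<in> borel_measurable M"
  unfolding soc_lhs_def
  by (intro borel_measurable_vec_lambda borel_measurable_add borel_measurable_times
      borel_measurable_const borel_measurable_sum
      borel_measurable_sqrt borel_measurable_inner borel_measurable_matrix_vector_mult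
      borel_measurable_vec_nth borel_measurable_coeffs assms) auto

lemma borel_measurable_objective:
  assumes "\<And>t. t < n \<Longrightarrow> (\<lambda>w. \<xi> w t) \<in> borel_measurable M"
    "\<And>t. t < n \<Longrightarrow> (\<lambda>w. x w t) \<in> borel_measurable M"
  shows "(\<lambda>w. objective n (\<xi> w) (x w)) \<in> borel_measurable M"
  unfolding objective_def
  by (intro borel_measurable_sum borel_measurable_inner borel_measurable_coeffs assms) auto

text \<open>Replaces the random feasible set by a fixed finite index set, so that measurability
  follows from that of finite maxima.\<close>

lemma isocp_value_eq_Max:
  assumes "\<And>j. 0 \<le> b $ j"
  shows "isocp_value \<psi> n b \<xi> =
    Max ((\<lambda>x. if \<forall>j. soc_lhs \<psi> n \<xi> x $ j \<le> b $ j then objective n \<xi> x else 0)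
      ` (\<Pi>\<^sub>E t\<in>{..<n}. schemes))" (is "_ = Max (?f ` ?X)")
proof -
  let ?F = "isocp_feasible \<psi> n b \<xi>"
  have "objective n \<xi> ` ?F = ?f ` ?X"
  proof (intro equalityI image_subsetI)
    fix x assume x: "x \<in> ?F"
    let ?x = "restrict x {..<n}"
    have "objective n \<xi> x = ?f ?x" "?x \<in> ?X"
      using x by (auto simp: isocp_feasible_schemes soc_lhs_def objective_def)
    then show "objective n \<xi> x \<in> ?f ` ?X" by blast
  next
    fix x assume x: "x \<in> ?X"
    \<comment> \<open>The default value 0 given to infeasible tuples is attained by the feasible
      zero decision, so it does not change the maximum.\<close>
    have "(\<lambda>_. 0) \<in> ?F" "objective n \<xi> (\<lambda>_. 0) = 0"
      using assms by (auto simp: isocp_feasible_schemes soc_lhs_def objective_def)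
    moreover have "x \<in> ?F" if "\<forall>j. soc_lhs \<psi> n \<xi> x $ j \<le> b $ j"
      using x that by (auto simp: isocp_feasible_schemes)
    ultimately show "?f x \<in> objective n \<xi> ` ?F"
      by (auto intro: rev_image_eqI)
  qed
  then have eq: "isocp_value \<psi> n b \<xi> = Sup (?f ` ?X)"
    by (simp only: isocp_value_def)
  have "finite (?f ` ?X)"
    by (intro finite_imageI finite_PiE) auto
  moreover have "?f ` ?X \<noteq> {}"
    unfolding image_is_empty by (auto simp: PiE_eq_empty_iff intro: zero_in_schemes)
  ultimately show ?thesis
    unfolding eq by (rule cSup_eq_Max)
qed

lemma borel_measurable_isocp_value:
  assumes \<xi>: "\<And>t. t < n \<Longrightarrow> (\<lambda>w. \<xi> w t) \<in> borel_measurable M" and "\<And>j. 0 \<le> b $ j"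
  shows "(\<lambda>w. isocp_value \<psi> n b (\<xi> w)) \<in> borel_measurable M"
proof -
  have [measurable]: "(\<lambda>w. soc_lhs \<psi> n (\<xi> w) x) \<in> borel_measurable M"
    "(\<lambda>w. objective n (\<xi> w) x) \<in> borel_measurable M" for x
    by (auto intro: borel_measurable_soc_lhs borel_measurable_objective \<xi>)
  show ?thesis
    unfolding isocp_value_eq_Max[OF assms(2)]
    by (intro borel_measurable_Max finite_PiE) (auto, measurable)
qed

lemma borel_measurable_decision:
  fixes w :: "'a \<Rightarrow> ('m::finite, 'k::finite) coeffs \<times> 'k selector"
  assumes [measurable]: "p \<in> borel_measurable M" "(\<lambda>x. fst (w x)) \<in> borel_measurable M"
    "(\<lambda>x. snd (w x)) \<in> M \<rightarrow>\<^sub>M count_space UNIV"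
  shows "(\<lambda>x. decision \<psi> n (p x) (w x)) \<in> borel_measurable M"
proof -
  define r where "r x = reward (fst (w x)) - p x v* usage_adj \<psi> n (fst (w x))" for x
  define v where "v x = Max (range (\<lambda>l. r x $ l))" for x
  define S where "S x = {l. v x = r x $ l}" for x
  have [measurable]: "r \<in> borel_measurable M"
    unfolding r_def by measurable
  have [measurable]: "v \<in> borel_measurable M"
    unfolding v_def by (intro borel_measurable_Max) auto
  have [measurable]: "S \<in> M \<rightarrow>\<^sub>M count_space UNIV"
  proof (subst measurable_count_space_eq2, simp, intro conjI ballI)
    show "S \<in> space M \<rightarrow> UNIV" by simp
    fix A :: "'k set"
    \<comment> \<open>The tie set has finitely many possible values, and each value is described by
      finitely many comparisons of real random variables.\<close>
    have "S -` {A} \<inter> space M = {x \<in> space M. \<forall>l. (v x = r x $ l) = (l \<in> A)}"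
      by (auto simp: S_def)
    also have "\<dots> \<in> sets M" by measurable
    finally show "S -` {A} \<inter> space M \<in> sets M" .
  qed
  \<comment> \<open>Both the tie set and the selector range over finite types, so the composition is
    handled value by value, first over tie sets and then over selectors.\<close>
  have "(\<lambda>x. snd (w x) (S x)) \<in> M \<rightarrow>\<^sub>M count_space UNIV"
    by (rule measurable_compose_countable[where g = S])
      (auto intro: measurable_compose_countable[where g = "\<lambda>x. snd (w x)"])
  from measurable_compose_countable[OF borel_measurable_const this]
  have [measurable]: "(\<lambda>x. axis (snd (w x) (S x)) (1::real)) \<in> borel_measurable M" .
  have "(\<lambda>x. if 0 < v x then axis (snd (w x) (S x)) (1::real) else 0) \<in> borel_measurable M"
    by measurable
  then show ?thesis
    unfolding decision_def Let_def S_def v_def r_def .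
qed

lemma borel_measurable_price:
  assumes "\<And>s. s < t \<Longrightarrow> (\<lambda>x. fst (\<omega> x s)) \<in> borel_measurable M"
    "\<And>s. s < t \<Longrightarrow> (\<lambda>x. snd (\<omega> x s)) \<in> M \<rightarrow>\<^sub>M count_space UNIV"
  shows "(\<lambda>x. price \<psi> n d (\<omega> x) t) \<in> borel_measurable M"
  using assms
proof (induction t)
  case (Suc t)
  then have [measurable]: "(\<lambda>x. price \<psi> n d (\<omega> x) t) \<in> borel_measurable M"
    "(\<lambda>x. fst (\<omega> x t)) \<in> borel_measurable M"
    "(\<lambda>x. decision \<psi> n (price \<psi> n d (\<omega> x) t) (\<omega> x t)) \<in> borel_measurable M"
    by (auto intro!: borel_measurable_decision)
  show ?case
    unfolding price.simps Let_def by measurable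
qed simp

subsection \<open>Expected regret and violation\<close>

locale iid_online_soc = online_soc \<psi> D d_lo d_hi n d
  for \<psi> :: "real^'m::finite" and D d_lo d_hi :: real and n :: nat and d :: "real^'m" +
  fixes P :: "('m, 'k::finite) coeffs measure" and T :: "'k selector pmf"
  assumes prob_P: "prob_space P" and sets_P: "sets P = sets borel"
    and AE_cov: "AE z in P. \<forall>j. covariance_matrix (usage_cov z $ j)"
    and AE_bounded: "AE z in P. norm (reward z) \<le> D \<and> norm (usage_mean z) \<le> D \<and> norm (usage_cov z) \<le> D"
    and valid_T: "\<And>s. s \<in> set_pmf T \<Longrightarrow> valid_selector s"
begin

abbreviation N :: "(('m, 'k) coeffs \<times> 'k selector) measure" where
  "N \<equiv> P \<Otimes>\<^sub>M measure_pmf T"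

abbreviation R :: "(nat \<Rightarrow> ('m, 'k) coeffs \<times> 'k selector) measure" where
  "R \<equiv> run_space P T n"

abbreviation opt :: "(nat \<Rightarrow> ('m, 'k) coeffs \<times> 'k selector) \<Rightarrow> real" where
  "opt \<omega> \<equiv> isocp_value \<psi> n (real n *\<^sub>R d) (fst \<circ> \<omega>)"

lemma prob_N: "prob_space N"
  using prob_P by (intro prob_space_pair) (auto intro: measure_pmf.prob_space_axioms)

sublocale N: prob_space N by (rule prob_N)

text \<open>Provides the Fubini rule that splits off one coordinate of the product.\<close>

sublocale pi: product_prob_space "\<lambda>_::nat. N" by unfold_locales

sublocale R: prob_space R
  unfolding run_space_def by (rule prob_space_PiM) (rule prob_N)

lemma AE_admissible: "AE w in N. admissible D w"
proof -
  interpret P: prob_space P by (rule prob_P)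
  interpret pair_sigma_finite P "measure_pmf T" by unfold_locales
  \<comment> \<open>The first marginal of \<open>N\<close> is \<open>P\<close>, so almost sure
    properties of the coefficients lift to the pairs.\<close>
  have "AE z in distr N P fst.
      (\<forall>j. covariance_matrix (usage_cov z $ j)) \<and>
      norm (reward z) \<le> D \<and> norm (usage_mean z) \<le> D \<and> norm (usage_cov z) \<le> D"
    unfolding measure_pmf.distr_pair_fst using AE_cov AE_bounded by eventually_elim simp
  then have "AE w in N.
      (\<forall>j. covariance_matrix (usage_cov (fst w) $ j)) \<and>
      norm (reward (fst w)) \<le> D \<and> norm (usage_mean (fst w)) \<le> D \<and> norm (usage_cov (fst w)) \<le> D"
    by (rule AE_distrD[OF measurable_fst])
  moreover have "AE w in N. valid_selector (snd w)"
  proof (rule AE_pair_measure)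
    have "snd -` {s. valid_selector s} \<inter> space N \<in> sets N"
      by (rule measurable_sets[OF measurable_snd]) simp
    also have "snd -` {s. valid_selector s} \<inter> space N = {w \<in> space N. valid_selector (snd w)}"
      by auto
    finally show "{w \<in> space N. valid_selector (snd w)} \<in> sets N" .
    show "AE z in P. AE s in measure_pmf T. valid_selector (snd (z, s))"
      using valid_T by (simp add: AE_measure_pmf_iff)
  qed
  ultimately show ?thesis
    by eventually_elim (simp add: admissible_def)
qed

lemma AE_run_admissible: "AE \<omega> in R. \<forall>t<n. admissible D (\<omega> t)"
proof -
  have "AE \<omega> in R. \<forall>t\<in>{..<n}. admissible D (\<omega> t)"
    unfolding run_space_def
    by (intro AE_finite_allI AE_PiM_component prob_N AE_admissible) auto
  then show ?thesis by eventually_elim simp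
qed

lemma measurable_fst_N [measurable (raw)]:
  assumes "f \<in> M \<rightarrow>\<^sub>M N"
  shows "(\<lambda>x. fst (f x)) \<in> borel_measurable M"
  using measurable_compose[OF assms measurable_fst]
  unfolding measurable_cong_sets[OF refl sets_P] .

lemma measurable_snd_N [measurable (raw)]:
  assumes "f \<in> M \<rightarrow>\<^sub>M N"
  shows "(\<lambda>x. snd (f x)) \<in> M \<rightarrow>\<^sub>M count_space UNIV"
  using measurable_compose[OF assms measurable_snd]
  unfolding measurable_cong_sets[OF refl sets_measure_pmf_count_space[of T]] .

lemma measurable_run [measurable]: "t < n \<Longrightarrow> (\<lambda>\<omega>. \<omega> t) \<in> R \<rightarrow>\<^sub>M N"
  unfolding run_space_def by (intro measurable_component_singleton) simp

lemma measurable_run_price: "t \<le> n \<Longrightarrow> (\<lambda>\<omega>. price \<psi> n d \<omega> t) \<in> borel_measurable R"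
  by (intro borel_measurable_price measurable_fst_N measurable_snd_N measurable_run) auto

lemma measurable_surplus:
  assumes "p \<in> borel_measurable M" "w \<in> M \<rightarrow>\<^sub>M N"
  shows "(\<lambda>x. surplus (p x) (w x)) \<in> borel_measurable M"
  unfolding surplus_def reduced_def
  by (intro borel_measurable_inner borel_measurable_diff borel_measurable_coeffs
      borel_measurable_vector_matrix_mult borel_measurable_usage_adj borel_measurable_decision
      measurable_fst_N measurable_snd_N assms)

lemma measurable_alg_output:
  "t < n \<Longrightarrow> (\<lambda>\<omega>. alg_output \<psi> n d \<omega> t) \<in> borel_measurable R"
  unfolding alg_output_def
  by (intro borel_measurable_decision measurable_run_price measurable_fst_N measurable_snd_N
      measurable_run) auto

lemma measurable_fst_run: "t < n \<Longrightarrow> (\<lambda>\<omega>. (fst \<circ> \<omega>) t) \<in> borel_measurable R"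
  unfolding comp_def by (intro measurable_fst_N measurable_run)

section \<open>Integrability and the expected violation\<close>

lemma integrable_opt: "integrable R opt"
proof (rule R.integrable_const_bound)
  show "AE \<omega> in R. norm (opt \<omega>) \<le> real n * D"
    using AE_run_admissible by eventually_elim (simp add: isocp_value_bound)
  show "opt \<in> borel_measurable R"
    using d_pos by (intro borel_measurable_isocp_value measurable_fst_run) (auto simp: less_imp_le)
qed

lemma integrable_objective_alg:
  "integrable R (\<lambda>\<omega>. objective n (fst \<circ> \<omega>) (alg_output \<psi> n d \<omega>))"
proof (rule R.integrable_const_bound)
  show "AE \<omega> in R. norm (objective n (fst \<circ> \<omega>) (alg_output \<psi> n d \<omega>)) \<le> real n * D"
    using AE_run_admissible
    by eventually_elim (simp add: objective_bound alg_output_in_schemes)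
  show "(\<lambda>\<omega>. objective n (fst \<circ> \<omega>) (alg_output \<psi> n d \<omega>)) \<in> borel_measurable R"
    by (intro borel_measurable_objective measurable_fst_run measurable_alg_output)
qed

lemma integrable_violation: "integrable R (violation \<psi> n (real n *\<^sub>R d) d)"
proof (rule R.integrable_const_bound)
  show "AE \<omega> in R. norm (violation \<psi> n (real n *\<^sub>R d) d \<omega>) \<le> violation_bound * sqrt (real n)"
    using AE_run_admissible
  proof eventually_elim
    case (elim \<omega>)
    have "0 \<le> violation \<psi> n (real n *\<^sub>R d) d \<omega>" by (simp add: violation_def)
    with violation_le[of \<omega>] elim show ?case by simp
  qed
  have [measurable]: "(\<lambda>\<omega>. soc_lhs \<psi> n (fst \<circ> \<omega>) (alg_output \<psi> n d \<omega>)) \<in> borel_measurable R"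
    by (intro borel_measurable_soc_lhs measurable_fst_run measurable_alg_output)
  show "violation \<psi> n (real n *\<^sub>R d) d \<in> borel_measurable R"
    unfolding violation_def[abs_def] by measurable
qed

lemma expected_violation_le:
  "(\<integral>\<omega>. violation \<psi> n (real n *\<^sub>R d) d \<omega> \<partial>R) \<le> violation_bound * sqrt (real n)"
proof (rule R.integral_le_const[OF integrable_violation])
  show "AE \<omega> in R. violation \<psi> n (real n *\<^sub>R d) d \<omega> \<le> violation_bound * sqrt (real n)"
    using AE_run_admissible by eventually_elim (simp add: violation_le)
qed

section \<open>Expected dual values and the expected regret\<close>

lemma integrable_surplus: "integrable N (surplus p)"
proof (rule N.integrable_const_bound)
  show "AE w in N. norm (surplus p w) \<le> D + norm p * (step_bound + norm d)"
    using AE_admissible by eventually_elim (simp add: surplus_bound)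
  show "surplus p \<in> borel_measurable N"
    by (intro measurable_surplus) auto
qed

lemma integral_surplus_component:
  assumes "t < n"
  shows "integrable R (\<lambda>\<omega>. surplus p (\<omega> t))"
    and "(\<integral>\<omega>. surplus p (\<omega> t) \<partial>R) = (\<integral>w. surplus p w \<partial>N)"
proof -
  have distr: "distr R N (\<lambda>\<omega>. \<omega> t) = N"
    unfolding run_space_def using assms by (intro distr_PiM_component prob_N) simp
  have meas: "surplus p \<in> borel_measurable N"
    by (intro measurable_surplus) auto
  show "integrable R (\<lambda>\<omega>. surplus p (\<omega> t))"
    using integrable_distr_eq[OF measurable_run[OF assms] meas] integrable_surplus[of p]
    by (simp add: distr)
  show "(\<integral>\<omega>. surplus p (\<omega> t) \<partial>R) = (\<integral>w. surplus p w \<partial>N)"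
    using integral_distr[OF measurable_run[OF assms] meas] by (simp add: distr)
qed

text \<open>For a deterministic price, all \<open>n\<close> terms of the pathwise dual bound have
  the same expectation, because the requests are identically distributed.\<close>

lemma expected_opt_le_dual:
  assumes "\<And>j. 0 \<le> p $ j"
  shows "(\<integral>\<omega>. opt \<omega> \<partial>R) / real n \<le> (\<integral>w. surplus p w \<partial>N) + p \<bullet> d"
proof -
  have int: "integrable R (\<lambda>\<omega>. surplus p (\<omega> t) + p \<bullet> d)" if "t < n" for t
    using integral_surplus_component[OF that] by simp
  have "(\<integral>\<omega>. opt \<omega> \<partial>R) \<le> (\<integral>\<omega>. (\<Sum>t<n. surplus p (\<omega> t) + p \<bullet> d) \<partial>R)"
  proof (rule integral_mono_AE[OF integrable_opt])
    show "integrable R (\<lambda>\<omega>. \<Sum>t<n. surplus p (\<omega> t) + p \<bullet> d)"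
      using int by (intro Bochner_Integration.integrable_sum) auto
    show "AE \<omega> in R. opt \<omega> \<le> (\<Sum>t<n. surplus p (\<omega> t) + p \<bullet> d)"
      using AE_run_admissible by eventually_elim (simp add: isocp_value_le_dual assms)
  qed
  also have "\<dots> = (\<Sum>t<n. \<integral>\<omega>. surplus p (\<omega> t) + p \<bullet> d \<partial>R)"
    using int by (intro Bochner_Integration.integral_sum) auto
  also have "\<dots> = (\<Sum>t<n. (\<integral>w. surplus p w \<partial>N) + p \<bullet> d)"
    using integral_surplus_component by (intro sum.cong) (auto simp: R.prob_space)
  finally show ?thesis
    using n_pos by (simp add: divide_le_eq mult.commute)
qed

lemma integrable_surplus_price:
  assumes "t < n"
  shows "integrable R (\<lambda>\<omega>. surplus (price \<psi> n d \<omega> t) (\<omega> t) + price \<psi> n d \<omega> t \<bullet> d)"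
proof (rule R.integrable_const_bound)
  have [measurable]: "(\<lambda>\<omega>. price \<psi> n d \<omega> t) \<in> borel_measurable R"
    "(\<lambda>\<omega>. surplus (price \<psi> n d \<omega> t) (\<omega> t)) \<in> borel_measurable R"
    using assms by (auto intro!: measurable_surplus measurable_run_price measurable_run)
  show "(\<lambda>\<omega>. surplus (price \<psi> n d \<omega> t) (\<omega> t) + price \<psi> n d \<omega> t \<bullet> d) \<in> borel_measurable R"
    by measurable
  show "AE \<omega> in R. norm (surplus (price \<psi> n d \<omega> t) (\<omega> t) + price \<psi> n d \<omega> t \<bullet> d)
    \<le> D + price_bound * (step_bound + norm d) + price_bound * norm d"
    using AE_run_admissible
  proof eventually_elim
    case (elim \<omega>)
    let ?p = "price \<psi> n d \<omega> t"
    have p: "norm ?p \<le> price_bound"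
      using elim assms by (intro norm_price_le) auto
    have "\<bar>surplus ?p (\<omega> t)\<bar> \<le> D + norm ?p * (step_bound + norm d)"
      using elim assms by (intro surplus_bound) auto
    also have "\<dots> \<le> D + price_bound * (step_bound + norm d)"
      using p step_bound_nonneg by (intro add_left_mono mult_right_mono) auto
    finally have 1: "\<bar>surplus ?p (\<omega> t)\<bar> \<le> D + price_bound * (step_bound + norm d)" .
    have "\<bar>?p \<bullet> d\<bar> \<le> norm ?p * norm d"
      by (rule Cauchy_Schwarz_ineq2)
    also have "\<dots> \<le> price_bound * norm d"
      using p by (intro mult_right_mono) auto
    finally show ?case using 1 by simp
  qed
qed

text \<open>The price at time \<open>t\<close> is independent of request \<open>t\<close>, so Fubini reduces the claim to the dual
  bound at a fixed price.\<close>

lemma expected_opt_le_surplus_price: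
  assumes "t < n"
  shows "(\<integral>\<omega>. opt \<omega> \<partial>R) / real n
    \<le> (\<integral>\<omega>. surplus (price \<psi> n d \<omega> t) (\<omega> t) + price \<psi> n d \<omega> t \<bullet> d \<partial>R)"
proof -
  let ?c = "(\<integral>\<omega>. opt \<omega> \<partial>R) / real n"
  \<comment> \<open>Subtracting the constant turns the claim into nonnegativity, for which
    nonnegative inner integrals suffice.\<close>
  define g where "g \<omega> = surplus (price \<psi> n d \<omega> t) (\<omega> t) + price \<psi> n d \<omega> t \<bullet> d - ?c"
    for \<omega> :: "nat \<Rightarrow> ('m, 'k) coeffs \<times> 'k selector"
  define I where "I = {..<n} - {t}"
  have R_eq: "R = (\<Pi>\<^sub>M i\<in>insert t I. N)"
    using assms by (simp add: run_space_def I_def insert_absorb)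
  have int_g: "integrable R g"
    unfolding g_def using integrable_surplus_price[OF assms] by simp
  have "(\<integral>\<omega>. g \<omega> \<partial>R) = (\<integral>x. (\<integral>y. g (x(t := y)) \<partial>N) \<partial>(\<Pi>\<^sub>M i\<in>I. N))"
    unfolding R_eq
    by (rule pi.product_integral_insert) (use int_g in \<open>auto simp: I_def R_eq[unfolded I_def]\<close>)
  \<comment> \<open>This holds for every \<open>x\<close>, also off the admissible paths: clipping
    makes all prices nonnegative, and the dual bound asks for no more.\<close>
  moreover have "0 \<le> (\<integral>y. g (x(t := y)) \<partial>N)" for x
  proof -
    have "price \<psi> n d (x(t := y)) t = price \<psi> n d x t" for y
      by (rule price_cong) simp
    then have "(\<integral>y. g (x(t := y)) \<partial>N)
        = (\<integral>y. surplus (price \<psi> n d x t) y + (price \<psi> n d x t \<bullet> d - ?c) \<partial>N)"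
      by (simp add: g_def algebra_simps)
    also have "\<dots> = (\<integral>y. surplus (price \<psi> n d x t) y \<partial>N) + (price \<psi> n d x t \<bullet> d - ?c)"
      using integrable_surplus by (simp add: N.prob_space)
    also have "\<dots> \<ge> 0"
      using expected_opt_le_dual[of "price \<psi> n d x t"] price_nonneg[of \<psi> n d x t] by simp
    finally show ?thesis .
  qed
  ultimately have "0 \<le> (\<integral>\<omega>. g \<omega> \<partial>R)" by simp
  also have "\<dots> = (\<integral>\<omega>. surplus (price \<psi> n d \<omega> t) (\<omega> t) + price \<psi> n d \<omega> t \<bullet> d \<partial>R) - ?c"
    unfolding g_def using integrable_surplus_price[OF assms]
    by (simp add: R.prob_space del: Bochner_Integration.integral_add)
  finally show ?thesis by simp
qed

lemma integrable_regret: "integrable R (regret \<psi> n (real n *\<^sub>R d) d)"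
  unfolding regret_def[abs_def] using integrable_opt integrable_objective_alg by simp

lemma expected_regret_le:
  "(\<integral>\<omega>. regret \<psi> n (real n *\<^sub>R d) d \<omega> \<partial>R) \<le> step_bound\<^sup>2 / 2 * sqrt (real n)"
proof -
  let ?s = "\<lambda>t \<omega>. surplus (price \<psi> n d \<omega> t) (\<omega> t) + price \<psi> n d \<omega> t \<bullet> d"
  let ?obj = "\<lambda>\<omega>. objective n (fst \<circ> \<omega>) (alg_output \<psi> n d \<omega>)"
  have int: "integrable R (\<lambda>\<omega>. \<Sum>t<n. ?s t \<omega>)"
    using integrable_surplus_price by (intro Bochner_Integration.integrable_sum) auto
  \<comment> \<open>The optimum is split into \<open>n\<close> equal shares, each compared with the
    expected dual contribution at the price of one time step.\<close>
  have "(\<integral>\<omega>. opt \<omega> \<partial>R) = (\<Sum>t<n. (\<integral>\<omega>. opt \<omega> \<partial>R) / real n)"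
    using n_pos by simp
  also have "\<dots> \<le> (\<Sum>t<n. \<integral>\<omega>. ?s t \<omega> \<partial>R)"
    by (intro sum_mono expected_opt_le_surplus_price) simp
  also have "\<dots> = (\<integral>\<omega>. (\<Sum>t<n. ?s t \<omega>) \<partial>R)"
    using integrable_surplus_price by (intro Bochner_Integration.integral_sum[symmetric]) auto
  also have "\<dots> \<le> (\<integral>\<omega>. ?obj \<omega> + step_bound\<^sup>2 / 2 * sqrt (real n) \<partial>R)"
  proof (rule integral_mono_AE[OF int])
    show "integrable R (\<lambda>\<omega>. ?obj \<omega> + step_bound\<^sup>2 / 2 * sqrt (real n))"
      using integrable_objective_alg by simp
    show "AE \<omega> in R. (\<Sum>t<n. ?s t \<omega>) \<le> ?obj \<omega> + step_bound\<^sup>2 / 2 * sqrt (real n)"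
      using AE_run_admissible
    proof eventually_elim
      case (elim \<omega>)
      then show ?case using objective_alg_ge[of \<omega>] by simp
    qed
  qed
  also have "\<dots> = (\<integral>\<omega>. ?obj \<omega> \<partial>R) + step_bound\<^sup>2 / 2 * sqrt (real n)"
    using integrable_objective_alg by (simp add: R.prob_space)
  finally show ?thesis
    unfolding regret_def using integrable_opt integrable_objective_alg by simp
qed

end

theorem theorem4:
  fixes P :: "('m::finite, 'k::finite) coeffs measure"
    and T :: "'k selector pmf"
    and \<psi> :: "real^'m"
    and b d :: "nat \<Rightarrow> real^'m"
    and D d_lo d_hi :: real
  assumes "\<And>j. \<psi> $ j > 0"
    and "prob_space P" and "sets P = sets borel"
    and "AE z in P. \<forall>j. covariance_matrix (usage_cov z $ j)"
    and "AE z in P. norm (reward z) \<le> D \<and> norm (usage_mean z) \<le> D \<and> norm (usage_cov z) \<le> D"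
    and "\<And>s. s \<in> set_pmf T \<Longrightarrow> valid_selector s"
    and "\<And>n. n \<ge> 1 \<Longrightarrow> b n = real n *\<^sub>R d n"
    and "0 < d_lo" and "\<And>n j. n \<ge> 1 \<Longrightarrow> d_lo \<le> d n $ j \<and> d n $ j \<le> d_hi"
  shows "(\<exists>C\<ge>0. \<forall>n\<ge>1.
            integrable (run_space P T n) (regret \<psi> n (b n) (d n)) \<and>
            (\<integral>\<omega>. regret \<psi> n (b n) (d n) \<omega> \<partial>run_space P T n) \<le> C * sqrt (real n)) \<and>
         (\<exists>C\<ge>0. \<forall>n\<ge>1.
            integrable (run_space P T n) (violation \<psi> n (b n) (d n)) \<and>
            (\<integral>\<omega>. violation \<psi> n (b n) (d n) \<omega> \<partial>run_space P T n) \<le> C * sqrt (real n))"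
proof -
  \<comment> \<open>The sign of \<open>D\<close> follows from the almost sure norm bounds, since a
    probability measure has no almost sure contradiction.\<close>
  have "AE z in P. 0 \<le> D"
    using assms(5) by eventually_elim (meson norm_ge_zero order_trans)
  then have D: "0 \<le> D"
    using prob_space.AE_const[OF assms(2)] by simp
  have d: "d_lo \<le> d_hi"
    using assms(9)[of 1] by (meson order_refl order_trans)
  \<comment> \<open>Interpreting only the locale without the horizon makes the constants available
    before \<open>n\<close> is quantified.\<close>
  interpret soc_bounds \<psi> D d_lo d_hi
    by (rule soc_bounds.intro) (fact assms(1) D assms(8) d)+
  have iid: "iid_online_soc \<psi> D d_lo d_hi n (d n) P T" if "1 \<le> n" for n
  proof (intro iid_online_soc.intro online_soc.intro soc_bounds_axioms)
    show "online_soc_axioms d_lo d_hi n (d n)"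
      by (rule online_soc_axioms.intro) (use that assms(9)[OF that] in simp_all)
    show "iid_online_soc_axioms D P T"
      by (rule iid_online_soc_axioms.intro) (fact assms(2-6))+
  qed
  have regret: "integrable (run_space P T n) (regret \<psi> n (b n) (d n)) \<and>
      (\<integral>\<omega>. regret \<psi> n (b n) (d n) \<omega> \<partial>run_space P T n) \<le> step_bound\<^sup>2 / 2 * sqrt (real n)"
    if "1 \<le> n" for n
    unfolding assms(7)[OF that]
    using iid_online_soc.integrable_regret[OF iid[OF that]]
      iid_online_soc.expected_regret_le[OF iid[OF that]] by (rule conjI)
  have violation: "integrable (run_space P T n) (violation \<psi> n (b n) (d n)) \<and>
      (\<integral>\<omega>. violation \<psi> n (b n) (d n) \<omega> \<partial>run_space P T n) \<le> violation_bound * sqrt (real n)"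
    if "1 \<le> n" for n
    unfolding assms(7)[OF that]
    using iid_online_soc.integrable_violation[OF iid[OF that]]
      iid_online_soc.expected_violation_le[OF iid[OF that]] by (rule conjI)
  have "0 \<le> step_bound\<^sup>2 / 2" by simp
  note regret = regret this
  show ?thesis
  proof (rule conjI)
    show "\<exists>C\<ge>0. \<forall>n\<ge>1. integrable (run_space P T n) (regret \<psi> n (b n) (d n)) \<and>
        (\<integral>\<omega>. regret \<psi> n (b n) (d n) \<omega> \<partial>run_space P T n) \<le> C * sqrt (real n)"
      by (rule exI[of _ "step_bound\<^sup>2 / 2"]) (use regret in blast)
    show "\<exists>C\<ge>0. \<forall>n\<ge>1. integrable (run_space P T n) (violation \<psi> n (b n) (d n)) \<and>
        (\<integral>\<omega>. violation \<psi> n (b n) (d n) \<omega> \<partial>run_space P T n) \<le> C * sqrt (real n)"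
      using violation violation_bound_nonneg by (intro exI[of _ violation_bound]) blast
  qed
qed

end
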